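(* Let $\Bbbk$ be an algebraically closed field of characteristic zero. Let $H = \Bbbk\langle x,y,z \mid xz-zx,\ yz-zy,\ f\rangle$ and $H' = \Bbbk\langle x,y,z \mid xz-zx,\ yz-zy,\ f'\rangle$, where $f,f'\in\Bbbk\langle x,y,z\rangle$ are homogeneous of degree two and each has at least one nonzero coefficient among those of $x^2,xy,yx,y^2$. Let $M, M'\in\mathcal{M}_3(\Bbbk)$ be the defining matrices of $H$ and $H'$, respectively. Then $M$ and $M'$ are standard-form congruent if and only if $H\cong H'$ as $\Bbbk$-algebras.
   Context: $\Bbbk\langle x,y,z \mid r_1,r_2,\dots\rangle$ denotes the quotient of the free associative unital $\Bbbk$-algebra by the two-sided ideal generated by the listed elements. Defining matrix: modulo the relations $xz=zx$, $yz=zy$, write $f = m_{11}x^2+m_{12}xy+m_{21}yx+m_{22}y^2+m_{13}xz+m_{23}yz+m_{33}z^2$; the defining matrix of $H$ is $M=\begin{pmatrix} m_{11}&m_{12}&m_{13}\\ m_{21}&m_{22}&m_{23}\\ 0&0&m_{33}\end{pmatrix}$, and similarly for $H'$. Standard-form congruence: write $M\in\mathcal{M}_3(\Bbbk)$ in block form $M=\begin{pmatrix}M_1 & M_2\\ M_3^T & m\end{pmatrix}$ with $M_1\in\mathcal{M}_2(\Bbbk)$, $M_2,M_3\in\Bbbk^2$, $m\in\Bbbk$, and set $\mathrm{sf}(M)=\begin{pmatrix}M_1 & M_2+M_3\\ 0 & m\end{pmatrix}$. Let $\mathcal{P}_3=\left\{\begin{pmatrix}P_1&P_2\\0&1\end{pmatrix}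 : P_1\in \mathrm{GL}_2(\Bbbk),\ P_2\in\Bbbk^2\right\}$. Matrices $M,N\in\mathcal{M}_3(\Bbbk)$ are standard-form congruent if there exist $P\in\mathcal{P}_3$ and $\alpha\in\Bbbk^\times$ with $\mathrm{sf}(M)=\alpha\cdot\mathrm{sf}(P^TNP)$. *)

theory Defs
  imports
    "HOL-Analysis.Analysis"
    "HOL-Algebra.QuotRing"
    "HOL-Algebra.Module"
    "HOL-Library.Poly_Mapping"
begin

text \<open>
  The free algebra is the monoid algebra of the free monoid on the three generators.
  The product of \<^typ>\<open>'a \<Rightarrow>\<^sub>0 'b\<close> is convolution with respect to addition on the
  index type, so the free monoid is written additively: \<open>+\<close> is concatenation
  (not commutative) and \<open>0\<close> is the empty word.
\<close>

datatype gen = Gx | Gy | Gz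

datatype xyz_word = Word (letters: "gen list")

instantiation xyz_word :: monoid_add
begin

definition zero_xyz_word :: xyz_word where
  "0 = Word []"

definition plus_xyz_word :: "xyz_word \<Rightarrow> xyz_word \<Rightarrow> xyz_word" where
  "u + v = Word (letters u @ letters v)"

instance
  by standard (simp_all add: zero_xyz_word_def plus_xyz_word_def)

end

type_synonym 'k free_xyz = "xyz_word \<Rightarrow>\<^sub>0 'k"

definition scalar :: "'k \<Rightarrow> 'k::field free_xyz" where
  "scalar c = Poly_Mapping.single 0 c"

definition x_var :: "'k::field free_xyz" where
  "x_var = Poly_Mapping.single (Word [Gx]) 1"

definition y_var :: "'k::field free_xyz" where
  "y_var = Poly_Mapping.single (Word [Gy]) 1"

definition z_var :: "'k::field free_xyz" where
  "z_var = Poly_Mapping.single (Word [Gz]) 1"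

definition homogeneous :: "nat \<Rightarrow> 'k::field free_xyz \<Rightarrow> bool" where
  "homogeneous d f \<longleftrightarrow> (\<forall>w \<in> Poly_Mapping.keys f. length (letters w) = d)"

definition free_ring :: "'k::field free_xyz ring" where
  "free_ring = \<lparr>carrier = UNIV, mult = (*), one = 1, zero = 0, add = (+)\<rparr>"

text \<open>
  A (not necessarily commutative) \<open>\<bbbk>\<close>-algebra is represented by a record of type
  \<^typ>\<open>('k, 'a) module\<close>, that is, a ring together with a scalar multiplication.
  In HOL-Algebra, \<^const>\<open>ideal\<close> means two-sided ideal, and \<^const>\<open>genideal\<close>
  is the two-sided ideal generated by a set.
\<close>

definition presented_algebra ::
    "'k::field free_xyz set \<Rightarrow> ('k, 'k free_xyz set) module" where
  "presented_algebra R =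
     (let I = genideal free_ring R; Q = free_ring Quot I in
      \<lparr>carrier = carrier Q, mult = mult Q, one = one Q, zero = zero Q, add = add Q,
       smult = (\<lambda>c a. mult Q (I +>\<^bsub>free_ring\<^esub> scalar c) a)\<rparr>)"

definition algebra_iso :: "('k, 'a) module \<Rightarrow> ('k, 'b) module \<Rightarrow> ('a \<Rightarrow> 'b) set" where
  "algebra_iso A B =
     {h \<in> ring_iso A B. \<forall>c. \<forall>a \<in> carrier A. h (c \<odot>\<^bsub>A\<^esub> a) = c \<odot>\<^bsub>B\<^esub> h a}"

definition algebra_isomorphic :: "('k, 'a) module \<Rightarrow> ('k, 'b) module \<Rightarrow> bool" where
  "algebra_isomorphic A B \<longleftrightarrow> algebra_iso A B \<noteq> {}"

definition central_relations :: "'k::field free_xyz set" where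
  "central_relations = {x_var * z_var - z_var * x_var, y_var * z_var - z_var * y_var}"

definition H_algebra :: "'k::field free_xyz \<Rightarrow> ('k, 'k free_xyz set) module" where
  "H_algebra f = presented_algebra (central_relations \<union> {f})"

definition quadratic_of_matrix :: "'k::field^3^3 \<Rightarrow> 'k free_xyz" where
  "quadratic_of_matrix M =
     scalar (M$1$1) * x_var^2 + scalar (M$1$2) * (x_var * y_var)
   + scalar (M$2$1) * (y_var * x_var) + scalar (M$2$2) * y_var^2
   + scalar (M$1$3) * (x_var * z_var) + scalar (M$2$3) * (y_var * z_var)
   + scalar (M$3$3) * z_var^2"

definition is_defining_matrix :: "'k::field free_xyz \<Rightarrow> 'k^3^3 \<Rightarrow> bool" where
  "is_defining_matrix f M \<longleftrightarrow>
     M$3$1 = 0 \<and> M$3$2 = 0 \<and>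
     f - quadratic_of_matrix M \<in> genideal free_ring central_relations"

definition block_matrix :: "'k^2^2 \<Rightarrow> 'k^2 \<Rightarrow> 'k^2 \<Rightarrow> 'k::field \<Rightarrow> 'k^3^3" where
  "block_matrix M1 M2 M3 m =
     vector [vector [M1$1$1, M1$1$2, M2$1],
             vector [M1$2$1, M1$2$2, M2$2],
             vector [M3$1,   M3$2,   m]]"

definition sf :: "'k::field^3^3 \<Rightarrow> 'k^3^3" where
  "sf M = (let M1 = vector [vector [M$1$1, M$1$2], vector [M$2$1, M$2$2]];
               M2 = vector [M$1$3, M$2$3];
               M3 = vector [M$3$1, M$3$2]
           in block_matrix M1 (M2 + M3) 0 (M$3$3))"

definition P_three :: "('k::field^3^3) set" where
  "P_three = {block_matrix P1 P2 0 1 | P1 P2. invertible P1}"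

definition sf_congruent :: "'k::field^3^3 \<Rightarrow> 'k^3^3 \<Rightarrow> bool" where
  "sf_congruent M N \<longleftrightarrow>
     (\<exists>P \<in> P_three. \<exists>\<alpha>. \<alpha> \<noteq> 0 \<and> sf M = (\<chi> i j. \<alpha> * sf (transpose P ** N ** P) $ i $ j))"

lemma ring_free_ring: "ring (free_ring :: 'k::field free_xyz ring)"
proof (rule ringI)
  show "abelian_group (free_ring :: 'k free_xyz ring)"
    by (rule abelian_groupI)
       (auto simp: free_ring_def algebra_simps intro: exI[of _ "- x" for x])
  show "Group.monoid (free_ring :: 'k free_xyz ring)"
    by (rule monoidI) (auto simp: free_ring_def algebra_simps)
qed (auto simp: free_ring_def algebra_simps)

lemma block_matrix_decomposition:
  fixes M :: "'k::field^3^3"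
  shows "block_matrix (vector [vector [M$1$1, M$1$2], vector [M$2$1, M$2$2]])
           (vector [M$1$3, M$2$3]) (vector [M$3$1, M$3$2]) (M$3$3) = M"
  by (simp add: block_matrix_def vec_eq_iff forall_3)

lemma homogeneous_2_expansion:
  fixes f :: "'k::field free_xyz"
  assumes "homogeneous 2 f"
  shows "f = (\<Sum>a\<in>{Gx,Gy,Gz}. \<Sum>b\<in>{Gx,Gy,Gz}.
               Poly_Mapping.single (Word [a, b]) (Poly_Mapping.lookup f (Word [a, b])))"
proof (rule poly_mapping_eqI)
  fix w
  show "Poly_Mapping.lookup f w = Poly_Mapping.lookup (\<Sum>a\<in>{Gx,Gy,Gz}. \<Sum>b\<in>{Gx,Gy,Gz}.
               Poly_Mapping.single (Word [a, b]) (Poly_Mapping.lookup f (Word [a, b]))) w"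
  proof (cases "length (letters w) = 2")
    case True
    then obtain a b where "w = Word [a, b]"
      by (cases w) (auto simp: length_Suc_conv numeral_2_eq_2)
    then show ?thesis
      by (cases a; cases b) (simp_all add: lookup_add lookup_single)
  next
    case False
    then have "Poly_Mapping.lookup f w = 0"
      using assms by (auto simp: homogeneous_def in_keys_iff)
    moreover have "w \<noteq> Word [a, b]" for a b
      using False by auto
    ultimately show ?thesis
      by (simp add: lookup_add lookup_single when_def)
  qed
qed

lemma defining_matrix_exists:
  fixes f :: "'k::field free_xyz"
  assumes "homogeneous 2 f"
  shows "\<exists>M. is_defining_matrix f M"
proof -
  define c where "c a b = Poly_Mapping.lookup f (Word [a, b])" for a b
  define M :: "'k^3^3" where
    "M = vector [vector [c Gx Gx, c Gx Gy, c Gx Gz + c Gz Gx],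
                 vector [c Gy Gx, c Gy Gy, c Gy Gz + c Gz Gy],
                 vector [0, 0, c Gz Gz]]"
  note mults = scalar_def x_var_def y_var_def z_var_def mult_single
    plus_xyz_word_def zero_xyz_word_def power2_eq_square
  define g1 g2 :: "'k free_xyz"
    where "g1 = x_var * z_var - z_var * x_var" and "g2 = y_var * z_var - z_var * y_var"
  have "f - quadratic_of_matrix M = scalar (- c Gz Gx) * g1 + scalar (- c Gz Gy) * g2"
    by (subst homogeneous_2_expansion[OF assms])
       (simp add: M_def quadratic_of_matrix_def mults c_def[symmetric] g1_def g2_def
          algebra_simps single_add single_uminus)
  moreover have "scalar (- c Gz Gx) * g1 + scalar (- c Gz Gy) * g2 \<in> I"
    if I: "ideal I free_ring" and sub: "central_relations \<subseteq> I" for I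
  proof -
    have "g1 \<in> I" "g2 \<in> I"
      using sub by (auto simp: central_relations_def g1_def g2_def)
    then have "scalar (- c Gz Gx) * g1 \<in> I" "scalar (- c Gz Gy) * g2 \<in> I"
      using ideal.I_l_closed[OF I] by (auto simp: free_ring_def)
    then show ?thesis
      using additive_subgroup.a_closed[OF ideal.axioms(1)[OF I]]
      by (fastforce simp: free_ring_def)
  qed
  ultimately have "f - quadratic_of_matrix M \<in> genideal free_ring central_relations"
    by (auto simp: genideal_def)
  then have "is_defining_matrix f M"
    by (simp add: is_defining_matrix_def M_def)
  then show ?thesis ..
qed

end

theory Submission
  imports Defs
begin

text \<open>
  Write \<open>F\<close> for the free algebra. A matrix \<open>A\<close> stands for the quadratic element
  \<open>quad A\<close>, the sum of the \<open>A\<^sub>i\<^sub>j x\<^sub>i x\<^sub>j\<close>. Modulo the two commutators with \<open>z\<close> the relation \<open>f\<close>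
  is \<open>quad M\<close>, so \<open>H = F / I\<close> where \<open>I\<close> is generated by the quadratic elements of \<open>M\<close>,
  \<open>comm_xz\<close> and \<open>comm_yz\<close>. A linear substitution with matrix \<open>P\<close> sends \<open>quad A\<close> to
  \<open>quad (P\<^sup>T A P)\<close>, and \<open>sf\<close> forgets a matrix exactly up to the span of \<open>comm_xz\<close> and
  \<open>comm_yz\<close> (\<open>relation_span_iff_sf\<close>). So standard-form congruence says that a linear
  substitution fixing \<open>z\<close> carries one space of relations to the other, and such a substitution
  induces an isomorphism (\<open>iso_substitution_if_sf_congruent\<close>).

  Conversely, an isomorphism lifts to a substitution
  \<open>x\<^sub>i \<mapsto> c\<^sub>i + (L x)\<^sub>i + q\<^sub>i + \<dots>\<close> of \<open>F\<close> with constants \<open>c\<^sub>i\<close>, a linear part \<open>L\<close>, quadratic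
  parts \<open>q\<^sub>i\<close> and terms of higher degree. The ideals of relations start in degree two, and their
  elements have degree two part in the span of the given relations. Three comparisons of low degree
  coefficients then show that the isomorphism may be replaced by its linear part:
  \<^item> surjectivity forces \<open>L\<close> to be invertible (\<open>invertible_linear_part\<close>);
  \<^item> the image of a relation \<open>quad A\<close> has degree one part \<open>L\<^sup>T (A + A\<^sup>T) c\<close>, so
    \<open>(A + A\<^sup>T) c = 0\<close>;
  \<^item> in degree two the image is \<open>L\<^sup>T A L\<close> plus the sum of the \<open>((A + A\<^sup>T) c)\<^sub>j q\<^sub>j\<close>, and that
    sum is therefore zero (\<open>coeff2_subst_quad\<close>).

  So congruence by \<open>L\<close> carries relations to relations, and what is left is linear algebra
  (\<open>sf_congruent_if_relations_correspond\<close>). If \<open>z\<close> is sent to a multiple of \<open>z\<close>, then \<open>L\<close>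
  divided by the factor witnesses standard-form congruence. Otherwise a second linear form
  becomes central, which happens only if \<open>xy - yx\<close> is a relation; then both algebras are the
  commutative polynomial ring and \<open>M\<close>, \<open>M'\<close> are proportional.
\<close>

section \<open>The free algebra\<close>

text \<open>
  The letters are indexed by the type \<open>3\<close>, so that substitutions and quadratic elements can
  be described by the matrices of the problem.
\<close>

fun gen_index :: "gen \<Rightarrow> 3" where
  "gen_index Gx = 1" | "gen_index Gy = 2" | "gen_index Gz = 3"

definition gen_at :: "3 \<Rightarrow> gen" where
  "gen_at i = (if i = 1 then Gx else if i = 2 then Gy else Gz)"

definition var :: "3 \<Rightarrow> 'k::field free_xyz" where
  "var i = Poly_Mapping.single (Word [gen_at i]) 1"

lemma gen_at_simps [simp]: "gen_at 1 = Gx" "gen_at 2 = Gy" "gen_at 3 = Gz"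
  by (simp_all add: gen_at_def)

lemma gen_at_index [simp]: "gen_at (gen_index g) = g"
  by (cases g) simp_all

lemma gen_index_at [simp]: "gen_index (gen_at i) = i"
  using exhaust_3[of i] by auto

lemma gen_at_eq_iff [simp]: "gen_at i = gen_at j \<longleftrightarrow> i = j"
  by (metis gen_index_at)

lemma var_simps: "var 1 = x_var" "var 2 = y_var" "var 3 = z_var"
  by (simp_all add: var_def x_var_def y_var_def z_var_def)

lemma Word_eq_0_iff [simp]: "Word l = 0 \<longleftrightarrow> l = []"
  by (simp add: zero_xyz_word_def)

lemma Word_plus [simp]: "Word l + Word m = Word (l @ m)"
  by (simp add: plus_xyz_word_def)

lemma scalar_simps [simp]: "scalar 0 = 0" "scalar 1 = 1"
  by (simp_all add: scalar_def)

lemma scalar_add: "scalar (c + d) = scalar c + scalar d"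
  by (simp add: scalar_def single_add)

lemma scalar_mult: "scalar (c * d) = scalar c * scalar d"
  by (simp add: scalar_def mult_single)

lemma scalar_uminus: "scalar (- c) = - scalar c"
  by (simp add: scalar_def single_uminus)

lemma single_word_as_product:
  "Poly_Mapping.single w c = scalar c * prod_list (map (var \<circ> gen_index) (letters w))"
proof -
  have "prod_list (map (var \<circ> gen_index) l) = (Poly_Mapping.single (Word l) 1 :: 'a free_xyz)" for l
    by (induction l) (simp_all add: var_def mult_single flip: zero_xyz_word_def)
  then show ?thesis
    by (cases w) (simp add: scalar_def mult_single)
qed

lemma free_single_induct [case_names single add]:
  assumes "\<And>w c. P (Poly_Mapping.single w c)"
    and "\<And>a b. P a \<Longrightarrow> P b \<Longrightarrow> P (a + b)"
  shows "P (a :: 'k::field free_xyz)"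
proof (induction a rule: update_induct)
  case const
  show ?case using assms(1)[of undefined 0] by simp
next
  case (update a w c)
  have "Poly_Mapping.update w c a = Poly_Mapping.single w c + a"
    using update(1)
    by (intro poly_mapping_eqI)
       (auto simp: lookup_update lookup_add lookup_single when_def in_keys_iff)
  then show ?case using assms update by simp
qed

text \<open>
  Since scalars and letters generate the algebra, anything compatible with sums and products
  needs to be checked on them only.
\<close>

lemma free_algebra_induct [case_names scalar var add mult]:
  assumes scalar: "\<And>c. P (scalar c)"
    and var: "\<And>i. P (var i)"
    and add: "\<And>a b. P a \<Longrightarrow> P b \<Longrightarrow> P (a + b)"
    and mult: "\<And>a b. P a \<Longrightarrow> P b \<Longrightarrow> P (a * b)"
  shows "P (a :: 'k::field free_xyz)"
proof (induction a rule: free_single_induct)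
  case (single w c)
  have "P (prod_list (map (var \<circ> gen_index) l))" for l
    by (induction l) (use scalar[of 1] var mult in auto)
  then show ?case
    by (simp add: single_word_as_product scalar mult)
qed (rule add)

lemma scalar_commute: "scalar c * a = a * scalar c"
  by (induction a rule: free_single_induct)
     (simp_all add: scalar_def mult_single distrib_left distrib_right mult.commute)

section \<open>Substitutions\<close>

definition subst :: "(3 \<Rightarrow> 'k free_xyz) \<Rightarrow> 'k::field free_xyz \<Rightarrow> 'k free_xyz" where
  "subst u a = (\<Sum>w\<in>Poly_Mapping.keys a.
     scalar (Poly_Mapping.lookup a w) * prod_list (map (u \<circ> gen_index) (letters w)))"

lemma subst_superset:
  assumes "finite K" "Poly_Mapping.keys a \<subseteq> K"
  shows "subst u a = (\<Sum>w\<in>K.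
     scalar (Poly_Mapping.lookup a w) * prod_list (map (u \<circ> gen_index) (letters w)))"
  unfolding subst_def using assms
  by (intro sum.mono_neutral_left) (auto simp: in_keys_iff)

lemma subst_add [simp]: "subst u (a + b) = subst u a + subst u b"
proof -
  let ?K = "Poly_Mapping.keys a \<union> Poly_Mapping.keys b"
  have "Poly_Mapping.keys (a + b) \<subseteq> ?K" by (rule Poly_Mapping.keys_add)
  then show ?thesis
    by (simp add: subst_superset[of ?K] lookup_add scalar_add distrib_right sum.distrib)
qed

lemma subst_single:
  "subst u (Poly_Mapping.single w c) = scalar c * prod_list (map (u \<circ> gen_index) (letters w))"
  by (subst subst_superset[of "{w}"]) auto

lemma subst_scalar [simp]: "subst u (scalar c) = scalar c"
  unfolding scalar_def[of c] subst_single by (simp add: scalar_def zero_xyz_word_def)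

lemma subst_var [simp]: "subst u (var i) = u i"
  by (simp add: var_def subst_single)

lemma subst_mult [simp]: "subst u (a * b) = subst u a * subst u b"
proof (induction a rule: free_single_induct)
  case (single w c)
  show ?case
  proof (induction b rule: free_single_induct)
    case (single v d)
    let ?A = "prod_list (map (u \<circ> gen_index) (letters w))"
    let ?B = "prod_list (map (u \<circ> gen_index) (letters v))"
    have "subst u (Poly_Mapping.single w c * Poly_Mapping.single v d)
        = scalar c * (scalar d * ?A) * ?B"
      by (simp add: mult_single subst_single plus_xyz_word_def scalar_mult mult.assoc)
    also have "\<dots> = scalar c * (?A * scalar d) * ?B"
      by (simp only: scalar_commute[of d ?A])
    finally show ?case
      by (simp add: subst_single mult.assoc)
  qed (simp add: distrib_left)
qed (simp add: distrib_right)

lemma subst_0 [simp]: "subst u 0 = 0"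
  by (simp add: subst_def)

lemma subst_1 [simp]: "subst u 1 = 1"
  using subst_scalar[of u 1] by simp

lemma subst_uminus [simp]: "subst u (- a) = - subst u a"
  using subst_add[of u a "- a"] by (simp add: eq_neg_iff_add_eq_0 add.commute)

lemma subst_diff [simp]: "subst u (a - b) = subst u a - subst u b"
  using subst_add[of u a "- b"] by simp

lemma subst_sum [simp]: "subst u (sum a A) = (\<Sum>i\<in>A. subst u (a i))"
  by (induction A rule: infinite_finite_induct) simp_all

lemma subst_subst: "subst u (subst v a) = subst (\<lambda>i. subst u (v i)) a"
  by (induction a rule: free_algebra_induct) simp_all

lemma subst_var_self: "subst var a = a"
  by (induction a rule: free_algebra_induct) simp_all

section \<open>Coefficients of degree at most two\<close>

definition coeff0 :: "'k::field free_xyz \<Rightarrow> 'k" where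
  "coeff0 a = Poly_Mapping.lookup a 0"

definition coeff1 :: "'k::field free_xyz \<Rightarrow> 'k^3" where
  "coeff1 a = (\<chi> i. Poly_Mapping.lookup a (Word [gen_at i]))"

definition coeff2 :: "'k::field free_xyz \<Rightarrow> 'k^3^3" where
  "coeff2 a = (\<chi> i j. Poly_Mapping.lookup a (Word [gen_at i, gen_at j]))"

lemmas coeff_defs = coeff0_def coeff1_def coeff2_def

lemma coeff_add [simp]:
  "coeff0 (a + b) = coeff0 a + coeff0 b"
  "coeff1 (a + b) = coeff1 a + coeff1 b"
  "coeff2 (a + b) = coeff2 a + coeff2 b"
  by (simp_all add: coeff_defs lookup_add vec_eq_iff)

lemma coeff_diff [simp]:
  "coeff0 (a - b) = coeff0 a - coeff0 b"
  "coeff1 (a - b) = coeff1 a - coeff1 b"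
  "coeff2 (a - b) = coeff2 a - coeff2 b"
  by (simp_all add: coeff_defs lookup_minus vec_eq_iff)

lemma coeff_0 [simp]: "coeff0 0 = 0" "coeff1 0 = 0" "coeff2 0 = 0"
  by (simp_all add: coeff_defs vec_eq_iff)

lemma coeff_sum [simp]:
  "coeff0 (sum a A) = (\<Sum>i\<in>A. coeff0 (a i))"
  "coeff1 (sum a A) = (\<Sum>i\<in>A. coeff1 (a i))"
  "coeff2 (sum a A) = (\<Sum>i\<in>A. coeff2 (a i))"
  by (induction A rule: infinite_finite_induct) simp_all

lemma coeff_scalar [simp]:
  "coeff0 (scalar c) = c" "coeff1 (scalar c) = 0" "coeff2 (scalar c) = 0"
  by (simp_all add: coeff_defs vec_eq_iff lookup_single scalar_def zero_xyz_word_def)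

lemma coeff_var [simp]:
  "coeff0 (var i) = 0" "coeff1 (var i) = axis i 1" "coeff2 (var i) = 0"
  by (auto simp: coeff_defs vec_eq_iff lookup_single var_def zero_xyz_word_def axis_def when_def)

text \<open>
  A product up to degree two depends on the factors up to degree two only, so elements can be
  compared in the truncation of the free algebra at degree two.
\<close>

lemma coeff_mult:
  "coeff0 (a * b) = coeff0 a * coeff0 b"
  "coeff1 (a * b) $ i = coeff0 a * coeff1 b $ i + coeff1 a $ i * coeff0 b"
  "coeff2 (a * b) $ i $ j = coeff0 a * coeff2 b $ i $ j + coeff1 a $ i * coeff1 b $ j
     + coeff2 a $ i $ j * coeff0 b"
proof -
  have "coeff0 (a * b) = coeff0 a * coeff0 b \<and>
    coeff1 (a * b) $ i = coeff0 a * coeff1 b $ i + coeff1 a $ i * coeff0 b \<and>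
    coeff2 (a * b) $ i $ j = coeff0 a * coeff2 b $ i $ j + coeff1 a $ i * coeff1 b $ j
     + coeff2 a $ i $ j * coeff0 b"
  proof (induction a rule: free_single_induct)
    case (single w c)
    show ?case
    proof (induction b rule: free_single_induct)
      case (single v d)
      show ?case
        by (cases w; cases v)
           (auto simp: coeff_defs mult_single lookup_single when_def zero_xyz_word_def
              append_eq_Cons_conv)
    qed (simp add: algebra_simps)
  qed (simp add: algebra_simps)
  then show "coeff0 (a * b) = coeff0 a * coeff0 b"
    "coeff1 (a * b) $ i = coeff0 a * coeff1 b $ i + coeff1 a $ i * coeff0 b"
    "coeff2 (a * b) $ i $ j = coeff0 a * coeff2 b $ i $ j + coeff1 a $ i * coeff1 b $ j
     + coeff2 a $ i $ j * coeff0 b"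
    by blast+
qed

section \<open>Quadratic elements\<close>

definition quad :: "'k::field^3^3 \<Rightarrow> 'k free_xyz" where
  "quad A = (\<Sum>i\<in>UNIV. \<Sum>j\<in>UNIV. scalar (A$i$j) * (var i * var j))"

text \<open>
  The matrices of \<open>xz - zx\<close> and \<open>yz - zy\<close>.
\<close>

definition comm_xz :: "'k::field^3^3" where
  "comm_xz = vector [vector [0, 0, 1], vector [0, 0, 0], vector [-1, 0, 0]]"

definition comm_yz :: "'k::field^3^3" where
  "comm_yz = vector [vector [0, 0, 0], vector [0, 0, 1], vector [0, -1, 0]]"

text \<open>
  The degree two part of the ideal of relations, described by matrices.
\<close>

definition relation_span :: "'k::field^3^3 \<Rightarrow> 'k^3^3 \<Rightarrow> bool" where
  "relation_span M A \<longleftrightarrow> (\<exists>\<beta> \<gamma> \<delta>. \<forall>i j. A$i$j = \<beta> * M$i$j + \<gamma> * comm_xz$i$j + \<delta> * comm_yz$i$j)"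

lemma comm_nth [simp]:
  "comm_xz$1 = vector [0, 0, 1]" "comm_xz$2 = vector [0, 0, 0]" "comm_xz$3 = vector [-1, 0, 0]"
  "comm_yz$1 = vector [0, 0, 0]" "comm_yz$2 = vector [0, 0, 1]" "comm_yz$3 = vector [0, -1, 0]"
  by (simp_all add: comm_xz_def comm_yz_def)

lemma congruence_nth:
  fixes P A :: "'k::field^3^3"
  shows "(transpose P ** A ** P)$k$l = (\<Sum>i\<in>UNIV. \<Sum>j\<in>UNIV. A$i$j * (P$i$k * P$j$l))"
  by (simp add: matrix_matrix_mult_def transpose_def sum_3 algebra_simps)

lemma coeff_quad [simp]: "coeff0 (quad A) = 0" "coeff1 (quad A) = 0" "coeff2 (quad A) = A"
  by (simp_all add: quad_def vec_eq_iff coeff_mult sum_3 forall_3 axis_def)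

lemma subst_quad: "subst u (quad A) = (\<Sum>i\<in>UNIV. \<Sum>j\<in>UNIV. scalar (A$i$j) * (u i * u j))"
  by (simp add: quad_def)

lemma subst_linear_quad:
  fixes P A :: "'k::field^3^3"
  shows "subst (\<lambda>i. \<Sum>k\<in>UNIV. scalar (P$i$k) * var k) (quad A) = quad (transpose P ** A ** P)"
proof -
  have comm: "var k * (scalar c * a) = scalar c * (var k * a :: 'k free_xyz)" for k c a
    by (metis mult.assoc scalar_commute)
  have comm2: "scalar c * (scalar d * a) = scalar d * (scalar c * a :: 'k free_xyz)" for c d a
    by (metis mult.assoc scalar_commute)
  show ?thesis
    unfolding subst_quad
    by (simp add: quad_def congruence_nth sum_3 distrib_left distrib_right scalar_add
      scalar_mult mult.assoc comm comm2 add_ac)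
qed

text \<open>
  The degree one part of the substitution is a derivation twisted by its constant part, so it
  sends every element to a combination of the linear parts of the images of the letters.
\<close>

lemma coeff1_subst_span:
  "\<exists>d. coeff1 (subst u a) = d v* (\<chi> i. coeff1 (u i))"
proof (induction a rule: free_algebra_induct)
  case (scalar c)
  show ?case by (rule exI[of _ 0]) (simp add: vec_eq_iff vector_matrix_mult_def)
next
  case (var i)
  show ?case
    by (rule exI[of _ "axis i 1"])
       (simp add: vec_eq_iff vector_matrix_mult_def axis_def if_distrib if_distribR cong: if_cong)
next
  case (add a b)
  then obtain d e where "coeff1 (subst u a) = d v* (\<chi> i. coeff1 (u i))"
    "coeff1 (subst u b) = e v* (\<chi> i. coeff1 (u i))" by blast
  then show ?case
    by (intro exI[of _ "d + e"]) (simp add: vec_eq_iff vector_matrix_mult_def algebra_simps sum.distrib)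
next
  case (mult a b)
  then obtain d e where de: "coeff1 (subst u a) = d v* (\<chi> i. coeff1 (u i))"
    "coeff1 (subst u b) = e v* (\<chi> i. coeff1 (u i))" by blast
  show ?case
    by (rule exI[of _ "\<chi> i. coeff0 (subst u a) * e$i + d$i * coeff0 (subst u b)"])
       (simp add: vec_eq_iff coeff_mult de vector_matrix_mult_def sum_3 algebra_simps)
qed

text \<open>
  The degree one part comes from the products of a constant with a linear term; this is
  \<open>(A + A\<^sup>T) c\<close> applied to the linear part, with \<open>c\<close> the vector of constant terms.
\<close>

lemma coeff1_subst_quad:
  fixes A :: "'k::field^3^3"
  shows "coeff1 (subst u (quad A))
    = (\<chi> j. \<Sum>i\<in>UNIV. (A$i$j + A$j$i) * coeff0 (u i)) v* (\<chi> i. coeff1 (u i))"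
  by (simp add: vec_eq_iff subst_quad coeff_mult vector_matrix_mult_def sum_3 algebra_simps)

text \<open>
  The degree two part of the image also contains the products of the constants with the
  quadratic terms of the substitution, with total weight \<open>(A + A\<^sup>T) c\<close>. That weight vanishes
  together with the degree one part, because \<open>L\<close> is invertible. This is why a substitution that
  moves the origin behaves on relations like its linear part.
\<close>

lemma coeff2_subst_quad:
  fixes A :: "'k::field^3^3" and u
  defines "L \<equiv> \<chi> i. coeff1 (u i)"
  assumes L: "invertible L" and lin: "coeff1 (subst u (quad A)) = 0"
  shows "coeff2 (subst u (quad A)) = transpose L ** A ** L"
proof -
  define e where "e = (\<chi> j. \<Sum>i\<in>UNIV. (A$i$j + A$j$i) * coeff0 (u i))"
  obtain L' where L': "L ** L' = mat 1"
    using L by (auto simp: invertible_def)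
  have "e v* L = 0"
    using lin by (simp add: coeff1_subst_quad e_def L_def)
  then have "(e v* L) v* L' = 0"
    by (simp add: vec_eq_iff vector_matrix_mult_def)
  then have "e = 0"
    by (simp add: vector_matrix_mul_assoc L')
  then have e: "(\<Sum>i\<in>UNIV. (A$i$j + A$j$i) * coeff0 (u i)) = 0" for j
    by (simp add: e_def vec_eq_iff)
  show ?thesis
  proof (simp only: vec_eq_iff, intro allI)
    fix k l
    have "coeff2 (subst u (quad A))$k$l
      = (transpose L ** A ** L)$k$l
        + (\<Sum>j\<in>UNIV. (\<Sum>i\<in>UNIV. (A$i$j + A$j$i) * coeff0 (u i)) * coeff2 (u j)$k$l)"
      by (simp add: subst_quad coeff_mult congruence_nth L_def sum_3 algebra_simps)
    then show "coeff2 (subst u (quad A))$k$l = (transpose L ** A ** L)$k$l"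
      by (simp add: e)
  qed
qed

section \<open>Isomorphisms of presented algebras\<close>

lemma free_ring_simps [simp]:
  "carrier free_ring = UNIV" "a \<otimes>\<^bsub>free_ring\<^esub> b = a * b" "a \<oplus>\<^bsub>free_ring\<^esub> b = a + b"
  "\<one>\<^bsub>free_ring\<^esub> = 1" "\<zero>\<^bsub>free_ring\<^esub> = 0"
  by (simp_all add: free_ring_def)

lemma free_ring_a_inv: "\<ominus>\<^bsub>free_ring\<^esub> a = - (a :: 'k::field free_xyz)"
proof -
  interpret ring "free_ring :: 'k free_xyz ring" by (rule ring_free_ring)
  show ?thesis by (rule minus_equality) simp_all
qed

lemma free_idealI:
  fixes I :: "'k::field free_xyz set"
  assumes "0 \<in> I" "\<And>a b. a \<in> I \<Longrightarrow> b \<in> I \<Longrightarrow> a + b \<in> I"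
    and "\<And>a r. a \<in> I \<Longrightarrow> r * a \<in> I" "\<And>a r. a \<in> I \<Longrightarrow> a * r \<in> I"
  shows "ideal I free_ring"
proof (rule idealI[OF ring_free_ring])
  have "\<ominus>\<^bsub>free_ring\<^esub> a \<in> I" if "a \<in> I" for a
    using assms(3)[OF that, of "- 1"] by (simp add: free_ring_a_inv)
  then show "subgroup I (add_monoid free_ring)"
    by (intro subgroup.intro) (simp_all only: a_inv_def, simp_all add: assms)
qed (use assms in auto)

lemma free_ideal_closed:
  fixes I :: "'k::field free_xyz set"
  assumes "ideal I free_ring"
  shows "0 \<in> I" "a \<in> I \<Longrightarrow> b \<in> I \<Longrightarrow> a + b \<in> I" "a \<in> I \<Longrightarrow> b \<in> I \<Longrightarrow> a - b \<in> I"
    "a \<in> I \<Longrightarrow> r * a \<in> I" "a \<in> I \<Longrightarrow> a * r \<in> I" "a \<in> I \<Longrightarrow> - a \<in> I"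
proof -
  interpret ideal I free_ring by fact
  show z: "0 \<in> I"
    using additive_subgroup.zero_closed[OF is_additive_subgroup] by simp
  show p: "a + b \<in> I" if "a \<in> I" "b \<in> I" for a b
    using additive_subgroup.a_closed[OF is_additive_subgroup that] by simp
  show l: "r * a \<in> I" if "a \<in> I" for a r using I_l_closed[OF that] by simp
  show "a * r \<in> I" if "a \<in> I" for a r using I_r_closed[OF that] by simp
  show n: "- a \<in> I" if "a \<in> I" for a using l[OF that, of "-1"] by simp
  show "a - b \<in> I" if "a \<in> I" "b \<in> I" for a b using p[OF that(1) n[OF that(2)]] by simp
qed

lemma genideal_free_ring:
  fixes R :: "'k::field free_xyz set"
  shows "ideal (genideal free_ring R) free_ring" "R \<subseteq> genideal free_ring R"
    "ideal I free_ring \<Longrightarrow> R \<subseteq> I \<Longrightarrow> genideal free_ring R \<subseteq> I"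
  using ring.genideal_ideal[OF ring_free_ring] ring.genideal_self[OF ring_free_ring]
  by (auto simp: genideal_def)

abbreviation coset :: "'k::field free_xyz set \<Rightarrow> 'k free_xyz \<Rightarrow> 'k free_xyz set" where
  "coset I a \<equiv> I +>\<^bsub>free_ring\<^esub> a"

lemma coset_eq_iff:
  fixes I :: "'k::field free_xyz set"
  assumes "ideal I free_ring"
  shows "coset I a = coset I b \<longleftrightarrow> a - b \<in> I"
proof -
  interpret ideal I free_ring by fact
  note cl = free_ideal_closed[OF assms]
  have mem: "x \<in> coset I a \<longleftrightarrow> x - a \<in> I" for x a
    by (auto simp: a_r_coset_def' algebra_simps) (metis add.commute diff_add_cancel)
  show ?thesis
  proof
    assume "coset I a = coset I b"
    then show "a - b \<in> I" using mem[of a a] mem[of a b] cl(1) by simp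
  next
    assume ab: "a - b \<in> I"
    have "x - a \<in> I \<longleftrightarrow> x - b \<in> I" for x
      using cl(2)[OF _ ab, of "x - a"] cl(3)[OF _ ab, of "x - b"] by (auto simp: algebra_simps)
    then show "coset I a = coset I b" using mem by blast
  qed
qed

lemma presented_algebra_simps:
  fixes R :: "'k::field free_xyz set"
  defines "I \<equiv> genideal free_ring R"
  shows "carrier (presented_algebra R) = range (coset I)"
    "coset I a \<otimes>\<^bsub>presented_algebra R\<^esub> coset I b = coset I (a * b)"
    "coset I a \<oplus>\<^bsub>presented_algebra R\<^esub> coset I b = coset I (a + b)"
    "\<one>\<^bsub>presented_algebra R\<^esub> = coset I 1"
    "c \<odot>\<^bsub>presented_algebra R\<^esub> coset I a = coset I (scalar c * a)"
proof -
  interpret ideal I free_ring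
    unfolding I_def by (rule genideal_free_ring)
  show "carrier (presented_algebra R) = range (coset I)"
    by (auto simp: presented_algebra_def Let_def FactRing_def A_RCOSETS_def' I_def)
  show "coset I a \<otimes>\<^bsub>presented_algebra R\<^esub> coset I b = coset I (a * b)"
    using rcoset_mult_add[of a b]
    by (simp add: presented_algebra_def Let_def FactRing_def I_def)
  show "coset I a \<oplus>\<^bsub>presented_algebra R\<^esub> coset I b = coset I (a + b)"
    using a_rcos_sum[of a b]
    by (simp add: presented_algebra_def Let_def FactRing_def I_def)
  show "\<one>\<^bsub>presented_algebra R\<^esub> = coset I 1"
    by (simp add: presented_algebra_def Let_def FactRing_def I_def)
  show "c \<odot>\<^bsub>presented_algebra R\<^esub> coset I a = coset I (scalar c * a)"
    using rcoset_mult_add[of "scalar c" a]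
    by (simp add: presented_algebra_def Let_def FactRing_def I_def)
qed

text \<open>
  The substitutions that induce an isomorphism from \<open>F / I\<close> to \<open>F / J\<close>: the first condition
  makes the induced map well defined and injective, the second makes it surjective.
\<close>

definition iso_substitution ::
    "'k::field free_xyz set \<Rightarrow> 'k free_xyz set \<Rightarrow> (3 \<Rightarrow> 'k free_xyz) \<Rightarrow> bool" where
  "iso_substitution I J u \<longleftrightarrow>
     (\<forall>a. subst u a \<in> J \<longleftrightarrow> a \<in> I) \<and> (\<forall>b. \<exists>a. b - subst u a \<in> J)"

text \<open>
  The free algebra is projective: choosing representatives for the images of the three letters
  lifts an isomorphism of quotients to a substitution.
\<close>

lemma algebra_isomorphic_imp_substitution:
  fixes R S :: "'k::field free_xyz set"
  assumes "algebra_isomorphic (presented_algebra R) (presented_algebra S)"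
  shows "\<exists>u. iso_substitution (genideal free_ring R) (genideal free_ring S) u"
proof -
  let ?A = "presented_algebra R" and ?B = "presented_algebra S"
  define I J where "I = genideal free_ring R" and "J = genideal free_ring S"
  have I: "ideal I free_ring" and J: "ideal J free_ring"
    unfolding I_def J_def by (rule genideal_free_ring)+
  note A = presented_algebra_simps[of R, folded I_def]
  note B = presented_algebra_simps[of S, folded J_def]
  obtain h where h: "h \<in> ring_iso ?A ?B"
    and h_smult: "\<And>c a. a \<in> carrier ?A \<Longrightarrow> h (c \<odot>\<^bsub>?A\<^esub> a) = c \<odot>\<^bsub>?B\<^esub> h a"
    using assms by (auto simp: algebra_isomorphic_def algebra_iso_def)
  note hom = ring_iso_memE[OF h]
  have "\<exists>b. h (coset I (var i)) = coset J b" for i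
    using hom(1)[of "coset I (var i)"] by (auto simp: A B)
  then obtain u where u: "\<And>i. h (coset I (var i)) = coset J (u i)"
    by metis
  have lift: "h (coset I a) = coset J (subst u a)" for a
  proof (induction a rule: free_algebra_induct)
    case (scalar c)
    show ?case
      using h_smult[of "coset I 1" c] hom(4) by (simp add: A B)
  next
    case (add a b)
    then show ?case
      using hom(3)[of "coset I a" "coset I b"] by (simp add: A B)
  next
    case (mult a b)
    then show ?case
      using hom(2)[of "coset I a" "coset I b"] by (simp add: A B)
  qed (simp add: u)
  have "subst u a \<in> J \<longleftrightarrow> a \<in> I" for a
  proof -
    have "a \<in> I \<longleftrightarrow> coset I a = coset I 0"
      by (simp add: coset_eq_iff[OF I])
    also have "\<dots> \<longleftrightarrow> h (coset I a) = h (coset I 0)"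
      using bij_betw_imp_inj_on[OF hom(5)] by (auto simp: A inj_on_def)
    also have "\<dots> \<longleftrightarrow> subst u a \<in> J"
      by (simp add: lift coset_eq_iff[OF J])
    finally show ?thesis ..
  qed
  moreover have "\<exists>a. b - subst u a \<in> J" for b
  proof -
    have "coset J b \<in> h ` carrier ?A"
      using bij_betw_imp_surj_on[OF hom(5)] by (simp add: B)
    then show ?thesis
      by (auto simp: A lift coset_eq_iff[OF J])
  qed
  ultimately show ?thesis
    unfolding iso_substitution_def I_def J_def by blast
qed

lemma iso_substitution_imp_algebra_isomorphic:
  fixes R S :: "'k::field free_xyz set"
  assumes "iso_substitution (genideal free_ring R) (genideal free_ring S) u"
  shows "algebra_isomorphic (presented_algebra R) (presented_algebra S)"
proof -
  let ?A = "presented_algebra R" and ?B = "presented_algebra S"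
  define I J where "I = genideal free_ring R" and "J = genideal free_ring S"
  have I: "ideal I free_ring" and J: "ideal J free_ring"
    unfolding I_def J_def by (rule genideal_free_ring)+
  note A = presented_algebra_simps[of R, folded I_def]
  note B = presented_algebra_simps[of S, folded J_def]
  have ker: "subst u a \<in> J \<longleftrightarrow> a \<in> I" and sur: "\<exists>a. b - subst u a \<in> J" for a b
    using assms by (auto simp: iso_substitution_def I_def J_def)
  have wd: "coset J (subst u a) = coset J (subst u b) \<longleftrightarrow> coset I a = coset I b" for a b
    using ker[of "a - b"] by (simp add: coset_eq_iff I J)
  define h where "h C = coset J (subst u (SOME a. C = coset I a))" for C
  have h: "h (coset I a) = coset J (subst u a)" for a
  proof -
    have "coset I a = coset I (SOME b. coset I a = coset I b)"
      by (rule someI) (rule refl)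
    then show ?thesis unfolding h_def wd by simp
  qed
  have "bij_betw h (carrier ?A) (carrier ?B)"
    unfolding bij_betw_def
  proof
    show "inj_on h (carrier ?A)"
      by (auto simp: inj_on_def A h wd)
    show "h ` carrier ?A = carrier ?B"
    proof (intro equalityI subsetI)
      fix D assume "D \<in> carrier ?B"
      then obtain b where b: "D = coset J b" by (auto simp: B)
      obtain a where "b - subst u a \<in> J" using sur by blast
      then have "D = h (coset I a)" by (simp add: b h coset_eq_iff[OF J])
      then show "D \<in> h ` carrier ?A" by (auto simp: A)
    qed (auto simp: A B h)
  qed
  then have "h \<in> ring_iso ?A ?B"
    by (intro ring_iso_memI) (auto simp: A B h)
  moreover have "h (c \<odot>\<^bsub>?A\<^esub> a) = c \<odot>\<^bsub>?B\<^esub> h a" if "a \<in> carrier ?A" for a c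
    using that by (auto simp: A B h)
  ultimately show ?thesis
    by (auto simp: algebra_isomorphic_def algebra_iso_def)
qed

text \<open>
  Preimages of the letters modulo \<open>J\<close> define a substitution \<open>v\<close> with \<open>u \<circ> v\<close> the identity
  modulo \<open>J\<close>; that \<open>v\<close> reflects and preserves membership is then read off through \<open>u\<close>.
\<close>

lemma iso_substitution_sym:
  fixes I J :: "'k::field free_xyz set"
  assumes J: "ideal J free_ring" and u: "iso_substitution I J u"
  shows "\<exists>v. iso_substitution J I v"
proof -
  note cl = free_ideal_closed[OF J]
  have ker: "subst u a \<in> J \<longleftrightarrow> a \<in> I" and sur: "\<exists>a. b - subst u a \<in> J" for a b
    using u by (auto simp: iso_substitution_def)
  have "\<forall>i. \<exists>a. var i - subst u a \<in> J"
    using sur by blast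
  from choice[OF this] obtain v where v: "\<And>i. var i - subst u (v i) \<in> J"
    by blast
  have retract: "b - subst u (subst v b) \<in> J" for b
  proof (induction b rule: free_algebra_induct)
    case (add a b)
    then show ?case using cl(2)[OF add] by (simp add: algebra_simps)
  next
    case (mult a b)
    have "a * b - subst u (subst v (a * b))
        = (a - subst u (subst v a)) * b + subst u (subst v a) * (b - subst u (subst v b))"
      by (simp add: algebra_simps)
    then show ?case using mult cl by simp
  qed (use v cl in auto)
  have "subst v b \<in> I \<longleftrightarrow> b \<in> J" for b
    using cl(2)[OF retract[of b], of "subst u (subst v b)"] cl(3)[OF _ retract[of b], of b]
    by (auto simp flip: ker)
  moreover have "a - subst v (subst u a) \<in> I" for a
    using retract[of "subst u a"] by (simp flip: ker)
  ultimately have "iso_substitution J I v"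
    unfolding iso_substitution_def by blast
  then show ?thesis by (rule exI[of _ v])
qed

section \<open>The ideal of relations\<close>

definition relation_ideal :: "'k::field^3^3 \<Rightarrow> 'k free_xyz set" where
  "relation_ideal M = genideal free_ring (central_relations \<union> {quad M})"

lemma relation_ideal: "ideal (relation_ideal M) free_ring"
  unfolding relation_ideal_def by (rule genideal_free_ring)

lemmas relation_ideal_closed = free_ideal_closed[OF relation_ideal]

lemma central_relations_eq: "central_relations = {quad comm_xz, quad comm_yz}"
  by (simp add: central_relations_def quad_def sum_3 scalar_uminus flip: var_simps)

lemma quadratic_of_matrix_eq_quad:
  assumes "M$3$1 = 0" "M$3$2 = 0"
  shows "quadratic_of_matrix M = quad M"
  using assms
  by (simp add: quadratic_of_matrix_def quad_def sum_3 power2_eq_square add_ac flip: var_simps)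

lemma quad_linear:
  assumes "\<And>i j. A$i$j = \<beta> * M$i$j + \<gamma> * B$i$j + \<delta> * C$i$j"
  shows "quad A = scalar \<beta> * quad M + scalar \<gamma> * quad B + scalar \<delta> * quad C"
  by (simp add: quad_def assms sum_3 scalar_add scalar_mult distrib_left distrib_right mult.assoc add_ac)

lemma relation_ideal_generators:
  "quad M \<in> relation_ideal M" "quad comm_xz \<in> relation_ideal M" "quad comm_yz \<in> relation_ideal M"
  using genideal_free_ring(2)[of "central_relations \<union> {quad M}"]
  by (auto simp: relation_ideal_def central_relations_eq)

lemma relation_span_imp_quad_mem:
  assumes "relation_span M A"
  shows "quad A \<in> relation_ideal M"
proof -
  obtain \<beta> \<gamma> \<delta> where "A$i$j = \<beta> * M$i$j + \<gamma> * comm_xz$i$j + \<delta> * comm_yz$i$j" for i j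
    using assms unfolding relation_span_def by blast
  from quad_linear[OF this] show ?thesis
    by (simp add: relation_ideal_closed relation_ideal_generators)
qed

lemma relation_span_closed:
  "relation_span M 0"
  "relation_span M A \<Longrightarrow> relation_span M B \<Longrightarrow> relation_span M (A + B)"
  "relation_span M A \<Longrightarrow> (\<And>i j. B$i$j = c * A$i$j) \<Longrightarrow> relation_span M B"
proof -
  show "relation_span M 0"
    unfolding relation_span_def by (intro exI[of _ 0]) simp
  show "relation_span M (A + B)" if AB: "relation_span M A" "relation_span M B"
  proof -
    obtain \<beta> \<gamma> \<delta> \<beta>' \<gamma>' \<delta>' where
      "\<And>i j. A$i$j = \<beta> * M$i$j + \<gamma> * comm_xz$i$j + \<delta> * comm_yz$i$j"
      "\<And>i j. B$i$j = \<beta>' * M$i$j + \<gamma>' * comm_xz$i$j + \<delta>' * comm_yz$i$j"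
      using AB unfolding relation_span_def by blast
    then show ?thesis
      unfolding relation_span_def
      by (intro exI[of _ "\<beta> + \<beta>'"] exI[of _ "\<gamma> + \<gamma>'"] exI[of _ "\<delta> + \<delta>'"])
         (simp add: algebra_simps)
  qed
  show "relation_span M B" if A: "relation_span M A" and B: "\<And>i j. B$i$j = c * A$i$j"
  proof -
    obtain \<beta> \<gamma> \<delta> where
      "\<And>i j. A$i$j = \<beta> * M$i$j + \<gamma> * comm_xz$i$j + \<delta> * comm_yz$i$j"
      using A unfolding relation_span_def by blast
    then show ?thesis
      unfolding relation_span_def
      by (intro exI[of _ "c * \<beta>"] exI[of _ "c * \<gamma>"] exI[of _ "c * \<delta>"])
         (simp add: B algebra_simps)
  qed
qed

lemma relation_span_generators:
  "relation_span M M" "relation_span M comm_xz" "relation_span M comm_yz"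
proof -
  show "relation_span M M"
    unfolding relation_span_def by (intro exI[of _ 1] exI[of _ 0]) simp
  show "relation_span M comm_xz"
    unfolding relation_span_def by (rule exI[of _ 0], rule exI[of _ 1], rule exI[of _ 0]) simp
  show "relation_span M comm_yz"
    unfolding relation_span_def by (rule exI[of _ 0], rule exI[of _ 0], rule exI[of _ 1]) simp
qed

text \<open>
  The conditions in the conclusion cut out an ideal that contains the relations: in a product
  with a member, only the constant term of the other factor reaches degree two.
\<close>

lemma relation_ideal_coeff:
  assumes "a \<in> relation_ideal M"
  shows "coeff0 a = 0" "coeff1 a = 0" "relation_span M (coeff2 a)"
proof -
  let ?T = "{a. coeff0 a = 0 \<and> coeff1 a = 0 \<and> relation_span M (coeff2 a)}"
  have "ideal ?T free_ring"
  proof (rule free_idealI)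
    fix a r :: "'a free_xyz" assume a: "a \<in> ?T"
    then show "r * a \<in> ?T" "a * r \<in> ?T"
      by (auto simp: coeff_mult vec_eq_iff intro: relation_span_closed(3)[of M "coeff2 a" _ "coeff0 r"])
  qed (auto simp: relation_span_closed)
  moreover have "central_relations \<union> {quad M} \<subseteq> ?T"
    by (auto simp: central_relations_eq relation_span_generators)
  ultimately have "relation_ideal M \<subseteq> ?T"
    unfolding relation_ideal_def by (rule genideal_free_ring(3))
  with assms show "coeff0 a = 0" "coeff1 a = 0" "relation_span M (coeff2 a)"
    by auto
qed

lemma is_defining_matrix_iff:
  "is_defining_matrix f M \<longleftrightarrow>
     M$3$1 = 0 \<and> M$3$2 = 0 \<and> f - quad M \<in> genideal free_ring central_relations"
  by (auto simp: is_defining_matrix_def quadratic_of_matrix_eq_quad)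

text \<open>
  A defining relation may be replaced by the quadratic element of its defining matrix, because
  the two differ by an element of the ideal of the commutators.
\<close>

lemma genideal_defining_matrix:
  assumes "is_defining_matrix f M"
  shows "genideal free_ring (central_relations \<union> {f}) = relation_ideal M"
proof -
  define C where "C = genideal free_ring (central_relations :: 'a free_xyz set)"
  have diff: "f - quad M \<in> C"
    using assms by (simp add: is_defining_matrix_iff C_def)
  have sub: "genideal free_ring (central_relations \<union> {g}) \<subseteq> genideal free_ring (central_relations \<union> {h})"
    if "g - h \<in> C" for g h
  proof -
    let ?J = "genideal free_ring (central_relations \<union> {h})"
    have J: "ideal ?J free_ring" "central_relations \<union> {h} \<subseteq> ?J"
      by (rule genideal_free_ring)+
    have "C \<subseteq> ?J"
      unfolding C_def using J by (intro genideal_free_ring(3)) auto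
    then have "(g - h) + h \<in> ?J"
      using that J by (intro free_ideal_closed(2)[OF J(1)]) auto
    then show ?thesis
      using J by (intro genideal_free_ring(3)) auto
  qed
  have "quad M - f \<in> C"
    using free_ideal_closed(6)[OF genideal_free_ring(1)] diff unfolding C_def by fastforce
  with diff sub show ?thesis
    unfolding relation_ideal_def by blast
qed

definition top_block_nonzero :: "'k::field^3^3 \<Rightarrow> bool" where
  "top_block_nonzero M \<longleftrightarrow> M$1$1 \<noteq> 0 \<or> M$1$2 \<noteq> 0 \<or> M$2$1 \<noteq> 0 \<or> M$2$2 \<noteq> 0"

text \<open>
  The commutators with \<open>z\<close> do not involve \<open>x\<^sup>2\<close>, \<open>xy\<close>, \<open>yx\<close> and \<open>y\<^sup>2\<close>, so the upper left
  block of the defining matrix holds the coefficients of \<open>f\<close> itself. Taking the third relation to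
  be zero in \<open>relation_ideal\<close> gives the ideal of the commutators alone.
\<close>

lemma defining_matrix_top_block_nonzero:
  assumes M: "is_defining_matrix f M"
    and f: "\<exists>w \<in> {Word [Gx, Gx], Word [Gx, Gy], Word [Gy, Gx], Word [Gy, Gy]}.
           Poly_Mapping.lookup f w \<noteq> 0"
  shows "top_block_nonzero M"
proof -
  have "genideal free_ring central_relations \<subseteq> relation_ideal 0"
    unfolding central_relations_eq
    by (rule genideal_free_ring(3)[OF relation_ideal]) (simp add: relation_ideal_generators)
  then have "f - quad M \<in> relation_ideal 0"
    using M by (auto simp: is_defining_matrix_iff)
  then have "relation_span 0 (coeff2 f - M)"
    using relation_ideal_coeff(3) by fastforce
  then obtain \<gamma> \<delta> where "(coeff2 f - M)$i$j = \<gamma> * comm_xz$i$j + \<delta> * comm_yz$i$j" for i j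
    unfolding relation_span_def by auto
  from this[of 1 1] this[of 1 2] this[of 2 1] this[of 2 2] show ?thesis
    using f by (auto simp: top_block_nonzero_def coeff2_def)
qed

section \<open>Congruence of matrices\<close>

text \<open>
  When \<open>z\<close> goes to a multiple of \<open>z\<close>, commutators with \<open>z\<close> go to commutators with \<open>z\<close>.
\<close>

lemma comm_congruence:
  fixes Q :: "'k::field^3^3"
  assumes "Q$3$1 = 0" "Q$3$2 = 0"
  shows "relation_span M (transpose Q ** comm_xz ** Q)" "relation_span M (transpose Q ** comm_yz ** Q)"
proof -
  have xz: "(transpose Q ** comm_xz ** Q)$i$j
      = Q$3$3 * Q$1$1 * comm_xz$i$j + Q$3$3 * Q$1$2 * comm_yz$i$j" for i j
    using exhaust_3[of i] exhaust_3[of j] assms by (auto simp: congruence_nth sum_3)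
  have yz: "(transpose Q ** comm_yz ** Q)$i$j
      = Q$3$3 * Q$2$1 * comm_xz$i$j + Q$3$3 * Q$2$2 * comm_yz$i$j" for i j
    using exhaust_3[of i] exhaust_3[of j] assms by (auto simp: congruence_nth sum_3)
  show "relation_span M (transpose Q ** comm_xz ** Q)"
    unfolding relation_span_def xz by (rule exI[of _ 0]) auto
  show "relation_span M (transpose Q ** comm_yz ** Q)"
    unfolding relation_span_def yz by (rule exI[of _ 0]) auto
qed

lemma relation_span_congruence:
  fixes Q :: "'k::field^3^3"
  assumes Q: "Q$3$1 = 0" "Q$3$2 = 0" and A: "relation_span M A"
  shows "relation_span (transpose Q ** M ** Q) (transpose Q ** A ** Q)"
proof -
  let ?c = "\<lambda>A. transpose Q ** A ** Q"
  obtain \<beta> \<gamma> \<delta> where A: "\<And>i j. A$i$j = \<beta> * M$i$j + \<gamma> * comm_xz$i$j + \<delta> * comm_yz$i$j"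
    using A unfolding relation_span_def by blast
  define sc where "sc c B = (\<chi> i j. c * B$i$j)" for c and B :: "'k^3^3"
  have "?c A = sc \<beta> (?c M) + sc \<gamma> (?c comm_xz) + sc \<delta> (?c comm_yz)"
    unfolding vec_eq_iff
    by (simp add: congruence_nth sc_def A sum_3 algebra_simps del: comm_nth)
  moreover have "relation_span (?c M) (sc c B)" if "relation_span (?c M) B" for c B
    using that by (rule relation_span_closed(3)[where c = c]) (simp add: sc_def)
  ultimately show ?thesis
    using comm_congruence[OF Q] by (simp add: relation_span_closed relation_span_generators)
qed

lemma inverse_bottom_row:
  fixes L L' :: "'k::field^3^3"
  assumes "L$3$1 = 0" "L$3$2 = 0" "L ** L' = mat 1"
  shows "L'$3$1 = 0" "L'$3$2 = 0" "L$3$3 \<noteq> 0"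
proof -
  have row: "L$3$3 * L'$3$j = (if j = 3 then 1 else 0)" for j
    using assms by (simp add: matrix_matrix_mult_def mat_def vec_eq_iff forall_3 sum_3)
      (use exhaust_3[of j] in auto)
  then show "L$3$3 \<noteq> 0" by (metis mult_zero_left one_neq_zero)
  then show "L'$3$1 = 0" "L'$3$2 = 0"
    using row[of 1] row[of 2] by auto
qed

lemma congruence_cancel:
  fixes L L' :: "'k::field^3^3"
  assumes "L ** L' = mat 1"
  shows "transpose L' ** (transpose L ** A ** L) ** L' = A"
proof -
  have "transpose L' ** transpose L = mat 1"
    using assms by (metis matrix_transpose_mul transpose_mat)
  then show ?thesis
    using assms by (metis matrix_mul_assoc matrix_mul_lid matrix_mul_rid)
qed

lemma congruence_scale:
  fixes L :: "'k::field^3^3"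
  assumes "\<And>i j. P$i$j = c * L$i$j"
  shows "(transpose P ** A ** P)$i$j = c\<^sup>2 * (transpose L ** A ** L)$i$j"
  by (simp add: congruence_nth assms sum_3 power2_eq_square algebra_simps)

lemma sf_nth:
  "sf A $ i $ j = (if i = 3 then (if j = 3 then A$3$3 else 0)
     else if j = 3 then A$i$3 + A$3$i else A$i$j)"
  using exhaust_3[of i] exhaust_3[of j] by (auto simp: sf_def block_matrix_def Let_def)

lemma sf_eq_self: "M$3$1 = 0 \<Longrightarrow> M$3$2 = 0 \<Longrightarrow> sf M = M"
  by (simp add: vec_eq_iff sf_nth forall_3)

text \<open>
  Standard form adds the entries of \<open>xz\<close> and \<open>zx\<close>, and those of \<open>yz\<close> and \<open>zy\<close>; its kernel
  is the span of the two commutator matrices, so passing to \<open>sf\<close> is working modulo them.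
\<close>

lemma relation_span_iff_sf:
  assumes "M$3$1 = 0" "M$3$2 = 0"
  shows "relation_span M A \<longleftrightarrow> (\<exists>\<beta>. \<forall>i j. sf A $ i $ j = \<beta> * M$i$j)"
proof
  assume "relation_span M A"
  then obtain \<beta> \<gamma> \<delta> where "A$i$j = \<beta> * M$i$j + \<gamma> * comm_xz$i$j + \<delta> * comm_yz$i$j" for i j
    unfolding relation_span_def by blast
  then have "\<forall>i j. sf A $ i $ j = \<beta> * M$i$j"
    by (simp add: forall_3 sf_nth assms)
  then show "\<exists>\<beta>. \<forall>i j. sf A $ i $ j = \<beta> * M$i$j" ..
next
  assume "\<exists>\<beta>. \<forall>i j. sf A $ i $ j = \<beta> * M$i$j"
  then obtain \<beta> where \<beta>: "\<And>i j. sf A $ i $ j = \<beta> * M$i$j" by blast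
  have "\<forall>i j. A$i$j = \<beta> * M$i$j + (- A$3$1) * comm_xz$i$j + (- A$3$2) * comm_yz$i$j"
    by (simp add: forall_3 sf_nth assms flip: \<beta>)
  then show "relation_span M A" unfolding relation_span_def by blast
qed

lemma P_three_iff:
  "P \<in> P_three \<longleftrightarrow> P$3$1 = 0 \<and> P$3$2 = 0 \<and> P$3$3 = 1 \<and> invertible P"
proof -
  have "P \<in> P_three \<longleftrightarrow> P$3$1 = 0 \<and> P$3$2 = 0 \<and> P$3$3 = 1 \<and> P$1$1 * P$2$2 - P$1$2 * P$2$1 \<noteq> 0"
    (is "_ \<longleftrightarrow> ?R")
  proof
    assume "P \<in> P_three"
    then show ?R
      by (auto simp: P_three_def block_matrix_def invertible_det_nz det_2)
  next
    assume R: ?R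
    let ?P1 = "vector [vector [P$1$1, P$1$2], vector [P$2$1, P$2$2]] :: 'a^2^2"
    have "P = block_matrix ?P1 (vector [P$1$3, P$2$3]) 0 1"
      using R by (simp add: block_matrix_def vec_eq_iff forall_3)
    moreover have "invertible ?P1"
      using R by (simp add: invertible_det_nz det_2)
    ultimately show "P \<in> P_three"
      unfolding P_three_def by blast
  qed
  then show ?thesis
    by (auto simp: invertible_det_nz det_3)
qed

text \<open>
  The diagonal condition excludes the squares of the letters in characteristic two as well.
\<close>

definition alternating :: "'k::field^3^3 \<Rightarrow> bool" where
  "alternating A \<longleftrightarrow> (\<forall>i. A$i$i = 0) \<and> (\<forall>i j. A$j$i = - A$i$j)"

lemma alternating_entries:
  assumes "alternating A"
  shows "A$1$1 = 0" "A$2$2 = 0" "A$3$3 = 0" "A$2$1 = - A$1$2" "A$3$1 = - A$1$3" "A$3$2 = - A$2$3"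
  using assms unfolding alternating_def by blast+

lemma alternating_congruence:
  fixes A Q :: "'k::field^3^3"
  assumes "alternating A"
  shows "alternating (transpose Q ** A ** Q)"
proof -
  have A: "A$1$1 = 0" "A$2$2 = 0" "A$3$3 = 0" "A$2$1 = - A$1$2" "A$3$1 = - A$1$3" "A$3$2 = - A$2$3"
    by (rule alternating_entries[OF assms])+
  show ?thesis
    by (simp add: alternating_def congruence_nth sum_3 A algebra_simps)
qed

lemma alternating_comm: "alternating (comm_xz :: 'a::field^3^3)" "alternating (comm_yz :: 'a::field^3^3)"
  by (simp_all add: alternating_def forall_3)

text \<open>
  The coefficient of \<open>xy\<close> in \<open>A\<close> can only come from \<open>M\<close>, which is thus a combination of \<open>A\<close> and
  the alternating commutator matrices.
\<close>

lemma alternating_relation_span: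
  assumes "M$3$1 = 0" "M$3$2 = 0" "relation_span M A" "alternating A" "A$1$2 \<noteq> 0"
  shows "alternating M"
proof -
  obtain \<beta> \<gamma> \<delta> where A: "A$i$j = \<beta> * M$i$j + \<gamma> * comm_xz$i$j + \<delta> * comm_yz$i$j" for i j
    using assms(3) unfolding relation_span_def by blast
  have alt: "A$1$1 = 0" "A$2$2 = 0" "A$3$3 = 0" "A$2$1 = - A$1$2" "A$3$1 = - A$1$3" "A$3$2 = - A$2$3"
    by (rule alternating_entries[OF assms(4)])+
  have "\<beta> \<noteq> 0" using assms(5) by (auto simp: A)
  have "\<beta> * M$1$1 = 0" "\<beta> * M$2$2 = 0" "\<beta> * M$3$3 = 0" "\<beta> * M$1$3 = 0" "\<beta> * M$2$3 = 0"
    "\<beta> * M$2$1 = \<beta> * (- M$1$2)"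
    using alt by (simp_all add: A assms(1,2))
  then have "M$1$1 = 0" "M$2$2 = 0" "M$3$3 = 0" "M$1$3 = 0" "M$2$3 = 0" "M$2$1 = - M$1$2"
    unfolding mult_cancel_left using \<open>\<beta> \<noteq> 0\<close> by simp_all
  then show ?thesis
    by (simp add: alternating_def forall_3 assms(1,2))
qed

lemma alternating_span:
  fixes M A :: "'a::field^3^3"
  assumes "alternating M" "relation_span M A"
  shows "alternating A"
proof -
  obtain \<beta> \<gamma> \<delta> where A: "\<And>i j. A$i$j = \<beta> * M$i$j + \<gamma> * comm_xz$i$j + \<delta> * comm_yz$i$j"
    using assms(2) unfolding relation_span_def by blast
  have "A$i$i = 0" for i
  proof -
    have "M$i$i = 0" "comm_xz$i$i = (0 :: 'a)" "comm_yz$i$i = (0 :: 'a)"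
      using assms(1) alternating_comm[where 'a='a] unfolding alternating_def by blast+
    then show ?thesis by (simp add: A)
  qed
  moreover have "A$j$i = - A$i$j" for i j
  proof -
    have "M$j$i = - M$i$j" "comm_xz$j$i = - (comm_xz$i$j :: 'a)" "comm_yz$j$i = - (comm_yz$i$j :: 'a)"
      using assms(1) alternating_comm[where 'a='a] unfolding alternating_def by blast+
    then show ?thesis by (simp add: A)
  qed
  ultimately show ?thesis unfolding alternating_def by blast
qed

text \<open>
  An alternating matrix with zero bottom row is a multiple of the matrix of \<open>xy - yx\<close>.
\<close>

lemma alternating_standard_form:
  assumes "alternating M" "M$3$1 = 0" "M$3$2 = 0"
  shows "M$1$1 = 0" "M$2$2 = 0" "M$3$3 = 0" "M$2$1 = - M$1$2" "M$1$3 = 0" "M$2$3 = 0"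
  using alternating_entries[OF assms(1)] assms(2,3) by simp_all

text \<open>
  Both matrices are nonzero multiples of the matrix of \<open>xy - yx\<close>, so the identity matrix
  witnesses the congruence.
\<close>

lemma sf_congruent_alternating:
  fixes M N :: "'k::field^3^3"
  assumes "alternating M" "alternating N"
    and "M$3$1 = 0" "M$3$2 = 0" "N$3$1 = 0" "N$3$2 = 0"
    and "top_block_nonzero M" "top_block_nonzero N"
  shows "sf_congruent M N"
proof -
  have M: "M$1$1 = 0" "M$2$2 = 0" "M$3$3 = 0" "M$2$1 = - M$1$2" "M$1$3 = 0" "M$2$3 = 0"
    by (rule alternating_standard_form[OF assms(1,3,4)])+
  have N: "N$1$1 = 0" "N$2$2 = 0" "N$3$3 = 0" "N$2$1 = - N$1$2" "N$1$3 = 0" "N$2$3 = 0"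
    by (rule alternating_standard_form[OF assms(2,5,6)])+
  have nz: "M$1$2 \<noteq> 0" "N$1$2 \<noteq> 0"
    using assms(7,8) by (auto simp: top_block_nonzero_def M N)
  have "mat 1 \<in> (P_three :: ('k^3^3) set)"
    by (simp add: P_three_iff invertible_det_nz) (simp add: mat_def)
  moreover have "sf M = (\<chi> i j. (M$1$2 / N$1$2) * sf (transpose (mat 1) ** N ** mat 1) $ i $ j)"
    using nz by (simp add: transpose_mat vec_eq_iff forall_3 sf_nth M N assms)
  moreover have "M$1$2 / N$1$2 \<noteq> 0" using nz by simp
  ultimately show ?thesis
    unfolding sf_congruent_def by blast
qed

text \<open>
  Row \<open>i\<close> of \<open>L\<close> is the linear part of the image of \<open>x\<^sub>i\<close>. If \<open>z\<close> goes to a multiple of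
  itself, \<open>L\<close> rescaled to fix \<open>z\<close> lies in \<open>P_three\<close>. If not, the commutators with the image of
  \<open>z\<close> provide an alternating relation that involves \<open>xy\<close>; it forces \<open>M\<close> to be alternating, and
  congruence transports this to \<open>N\<close>.
\<close>

lemma sf_congruent_if_relations_correspond:
  fixes L M N :: "'k::field^3^3"
  assumes L: "invertible L"
    and std: "M$3$1 = 0" "M$3$2 = 0" "N$3$1 = 0" "N$3$2 = 0"
    and nz: "top_block_nonzero M" "top_block_nonzero N"
    and xz: "relation_span M (transpose L ** comm_xz ** L)"
    and yz: "relation_span M (transpose L ** comm_yz ** L)"
    and N: "relation_span M (transpose L ** N ** L)"
  shows "sf_congruent M N"
proof -
  obtain L' where L': "L ** L' = mat 1"
    using L by (auto simp: invertible_def)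
  show ?thesis
  proof (cases "L$3$1 = 0 \<and> L$3$2 = 0")
    case True
    note L'3 = inverse_bottom_row[OF _ _ L', OF conjunct1[OF True] conjunct2[OF True]]
    define P where "P = (\<chi> i j. inverse (L$3$3) * L$i$j)"
    have P_nth: "P$i$j = inverse (L$3$3) * L$i$j" for i j
      by (simp add: P_def)
    have "det P \<noteq> 0"
      using L L'3(3) True by (simp add: invertible_det_nz P_def det_3)
    then have P: "P \<in> P_three"
      using L'3(3) True by (simp add: P_three_iff invertible_det_nz P_def)
    obtain \<beta> where \<beta>: "\<And>i j. sf (transpose L ** N ** L) $ i $ j = \<beta> * M$i$j"
      using N std by (auto simp: relation_span_iff_sf)
    \<comment> \<open>Otherwise congruence by the inverse of \<open>L\<close> would put \<open>N\<close> into the span of the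
      commutators.\<close>
    have "\<beta> \<noteq> 0"
    proof
      assume "\<beta> = 0"
      then have "relation_span 0 (transpose L ** N ** L)"
        using \<beta> by (simp add: relation_span_iff_sf)
      from relation_span_congruence[OF L'3(1,2) this]
      have "relation_span 0 N"
        by (simp add: congruence_cancel[OF L'])
      then have "sf N = 0"
        by (simp add: relation_span_iff_sf vec_eq_iff)
      then have "N = 0"
        by (simp add: sf_eq_self std)
      then show False
        using nz(2) by (simp add: top_block_nonzero_def)
    qed
    moreover have "sf (transpose P ** N ** P) $ i $ j
        = (inverse (L$3$3))\<^sup>2 * sf (transpose L ** N ** L) $ i $ j" for i j
      by (simp add: sf_nth congruence_scale[OF P_nth] distrib_left)
    ultimately have "sf M = (\<chi> i j. ((L$3$3)\<^sup>2 / \<beta>) * sf (transpose P ** N ** P) $ i $ j)"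
      using L'3(3) by (simp add: sf_eq_self std vec_eq_iff \<beta> power_inverse)
    moreover have "(L$3$3)\<^sup>2 / \<beta> \<noteq> 0"
      using \<open>\<beta> \<noteq> 0\<close> L'3(3) by simp
    ultimately show ?thesis
      using P unfolding sf_congruent_def by blast
  next
    case False
    \<comment> \<open>The two entries are the minors of \<open>L\<close> in the first two columns that pair the bottom row
      with one of the others. If both vanish, then in these columns the other rows are multiples of
      the bottom row, which is nonzero there, so \<open>L\<close> is singular.\<close>
    have "(transpose L ** comm_xz ** L)$1$2 \<noteq> 0 \<or> (transpose L ** comm_yz ** L)$1$2 \<noteq> 0"
    proof (rule ccontr)
      assume "\<not> ?thesis"
      then have e: "L$1$1 * L$3$2 = L$3$1 * L$1$2" "L$2$1 * L$3$2 = L$3$1 * L$2$2"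
        by (simp_all add: congruence_nth sum_3)
      have "L$1$1 * L$2$2 = L$1$2 * L$2$1"
      proof (cases "L$3$1 = 0")
        case True
        with e False show ?thesis by auto
      next
        case F: False
        have "L$3$1 * (L$1$1 * L$2$2) = L$1$1 * (L$3$1 * L$2$2)"
          by (rule mult.left_commute)
        also have "\<dots> = L$2$1 * (L$1$1 * L$3$2)"
          unfolding e(2)[symmetric] by (rule mult.left_commute)
        also have "\<dots> = L$3$1 * (L$1$2 * L$2$1)"
          unfolding e(1) by (simp only: ac_simps)
        finally have "L$3$1 * (L$1$1 * L$2$2) = L$3$1 * (L$1$2 * L$2$1)" .
        with F show ?thesis by simp
      qed
      moreover have "det L = L$3$3 * (L$1$1 * L$2$2 - L$1$2 * L$2$1)
          + L$1$3 * (L$2$1 * L$3$2 - L$3$1 * L$2$2) - L$2$3 * (L$1$1 * L$3$2 - L$3$1 * L$1$2)"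
        by (simp add: det_3 algebra_simps)
      ultimately have "det L = 0"
        using e by simp
      then show False
        using L by (simp add: invertible_det_nz)
    qed
    then have M: "alternating M"
      using alternating_relation_span[OF std(1,2) xz] alternating_relation_span[OF std(1,2) yz]
        alternating_congruence alternating_comm by blast
    have "alternating (transpose L' ** (transpose L ** N ** L) ** L')"
      by (intro alternating_congruence alternating_span[OF M N])
    then have "alternating N"
      by (simp add: congruence_cancel[OF L'])
    with M show ?thesis
      using std nz by (intro sf_congruent_alternating)
  qed
qed

section \<open>From isomorphisms to congruence\<close>

text \<open>
  Every letter is hit modulo the relations, which have no terms of degree one; so every unit
  vector is a combination of the linear parts of the images of the letters.
\<close>

lemma invertible_linear_part:
  fixes M :: "'a::field^3^3"
  assumes "iso_substitution I (relation_ideal M) u"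
  shows "invertible (\<chi> i. coeff1 (u i))"
proof -
  let ?L = "\<chi> i. coeff1 (u i)"
  have "\<exists>d. axis k 1 = d v* ?L" for k
  proof -
    obtain a where "var k - subst u a \<in> relation_ideal M"
      using assms unfolding iso_substitution_def by blast
    from relation_ideal_coeff(2)[OF this] have "axis k 1 = coeff1 (subst u a)"
      by simp
    then show ?thesis
      using coeff1_subst_span[of u a] by simp
  qed
  then have "\<forall>k. \<exists>d. axis k 1 = d v* ?L" by blast
  from choice[OF this] obtain d where d: "\<And>k. axis k 1 = d k v* ?L" by blast
  have "(\<chi> k. d k) ** ?L = mat 1"
    unfolding vec_eq_iff
  proof (intro allI)
    fix i j
    have "(axis i 1 :: 'a^3) $ j = (d i v* ?L) $ j"
      by (simp only: d)
    then show "((\<chi> k. d k) ** ?L) $ i $ j = mat 1 $ i $ j"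
      by (auto simp: matrix_matrix_mult_def vector_matrix_mult_def mat_def axis_def mult.commute)
  qed
  then show ?thesis
    using invertible_left_inverse by blast
qed

lemma sf_congruent_if_iso_substitution:
  fixes M N :: "'k::field^3^3"
  assumes std: "M$3$1 = 0" "M$3$2 = 0" "N$3$1 = 0" "N$3$2 = 0"
    and nz: "top_block_nonzero M" "top_block_nonzero N"
    and u: "iso_substitution (relation_ideal N) (relation_ideal M) u"
  shows "sf_congruent M N"
proof -
  define L where "L = (\<chi> i. coeff1 (u i))"
  have L: "invertible L"
    unfolding L_def using u by (rule invertible_linear_part)
  have "relation_span M (transpose L ** A ** L)" if "quad A \<in> relation_ideal N" for A
  proof -
    have "subst u (quad A) \<in> relation_ideal M"
      using u that by (auto simp: iso_substitution_def)
    note c = relation_ideal_coeff[OF this]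
    show ?thesis
      using coeff2_subst_quad[OF L[unfolded L_def] c(2)] c(3) by (simp add: L_def)
  qed
  then show ?thesis
    using relation_ideal_generators[of N]
    by (intro sf_congruent_if_relations_correspond[OF L std nz])
qed

section \<open>From congruence to isomorphisms\<close>

definition linear_subst :: "'k::field^3^3 \<Rightarrow> 3 \<Rightarrow> 'k free_xyz" where
  "linear_subst P i = (\<Sum>k\<in>UNIV. scalar (P$i$k) * var k)"

text \<open>
  The preimage of an ideal under a substitution is an ideal, so only the three generators have
  to be followed.
\<close>

lemma linear_subst_relation_ideal:
  fixes P M N :: "'k::field^3^3"
  assumes P: "P$3$1 = 0" "P$3$2 = 0" and N: "relation_span M (transpose P ** N ** P)"
    and a: "a \<in> relation_ideal N"
  shows "subst (linear_subst P) a \<in> relation_ideal M"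
proof -
  let ?K = "{a. subst (linear_subst P) a \<in> relation_ideal M}"
  have "ideal ?K free_ring"
    by (rule free_idealI) (auto simp: relation_ideal_closed)
  moreover have q: "quad A \<in> ?K" if "relation_span M (transpose P ** A ** P)" for A
    using relation_span_imp_quad_mem[OF that]
    by (simp add: linear_subst_def[abs_def] subst_linear_quad)
  have "central_relations \<union> {quad N} \<subseteq> ?K"
    using q[OF N] q[OF comm_congruence(1)[OF P]] q[OF comm_congruence(2)[OF P]]
    by (auto simp: central_relations_eq)
  ultimately have "relation_ideal N \<subseteq> ?K"
    unfolding relation_ideal_def[of N] by (intro genideal_free_ring(3))
  then show ?thesis using a by blast
qed

lemma linear_subst_inverse:
  fixes P Q :: "'k::field^3^3"
  assumes "P ** Q = mat 1"
  shows "subst (linear_subst Q) (subst (linear_subst P) a) = a"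
proof -
  have "subst (linear_subst Q) (linear_subst P i) = var i" for i
  proof -
    have "subst (linear_subst Q) (linear_subst P i) = (\<Sum>k\<in>UNIV. scalar ((P ** Q)$i$k) * var k)"
      by (simp add: linear_subst_def matrix_matrix_mult_def sum_3 scalar_add scalar_mult algebra_simps)
    also have "\<dots> = var i"
      using exhaust_3[of i] by (auto simp: assms mat_def sum_3)
    finally show ?thesis .
  qed
  then have "(\<lambda>i. subst (linear_subst Q) (linear_subst P i)) = var" by blast
  then show ?thesis
    by (simp add: subst_subst subst_var_self)
qed

text \<open>
  The substitutions given by the matrix \<open>P\<close> and by its inverse respect the relations and undo
  each other.
\<close>

lemma iso_substitution_if_sf_congruent:
  fixes M N :: "'k::field^3^3"
  assumes std: "M$3$1 = 0" "M$3$2 = 0" "N$3$1 = 0" "N$3$2 = 0"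
    and "sf_congruent M N"
  shows "\<exists>v. iso_substitution (relation_ideal M) (relation_ideal N) v"
proof -
  obtain P \<alpha> where P: "P \<in> P_three" and "\<alpha> \<noteq> 0"
    and sf: "sf M = (\<chi> i j. \<alpha> * sf (transpose P ** N ** P) $ i $ j)"
    using assms(5) unfolding sf_congruent_def by blast
  have P3: "P$3$1 = 0" "P$3$2 = 0" and "invertible P"
    using P by (auto simp: P_three_iff)
  obtain Q where PQ: "P ** Q = mat 1" and QP: "Q ** P = mat 1"
    using \<open>invertible P\<close> by (auto simp: invertible_def)
  note Q3 = inverse_bottom_row(1,2)[OF P3 PQ]
  define A where "A = transpose P ** N ** P"
  have M: "M$i$j = \<alpha> * sf A $ i $ j" for i j
    using sf by (simp add: sf_eq_self std A_def)
  then have MA: "relation_span M A"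
    using \<open>\<alpha> \<noteq> 0\<close> unfolding relation_span_iff_sf[OF std(1,2)]
    by (intro exI[of _ "inverse \<alpha>"]) simp
  \<comment> \<open>Passing from \<open>A\<close> to \<open>sf A\<close> moves the two entries of the bottom row into the last column,
    which adds multiples of the commutator matrices.\<close>
  have "\<forall>i j. M$i$j = \<alpha> * A$i$j + (\<alpha> * A$3$1) * comm_xz$i$j + (\<alpha> * A$3$2) * comm_yz$i$j"
    unfolding M by (simp add: forall_3 sf_nth algebra_simps)
  then have "relation_span A M"
    unfolding relation_span_def by blast
  from relation_span_congruence[OF Q3 this]
  have NM: "relation_span N (transpose Q ** M ** Q)"
    by (simp add: A_def congruence_cancel[OF PQ])
  note to_M = linear_subst_relation_ideal[OF P3 MA[unfolded A_def]]
  note to_N = linear_subst_relation_ideal[OF Q3 NM]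
  have "subst (linear_subst Q) a \<in> relation_ideal N \<longleftrightarrow> a \<in> relation_ideal M" for a
    using to_M[of "subst (linear_subst Q) a"] to_N[of a] linear_subst_inverse[OF QP, of a] by auto
  moreover have "\<exists>a. b - subst (linear_subst Q) a \<in> relation_ideal N" for b
    by (rule exI[of _ "subst (linear_subst P) b"])
       (simp add: linear_subst_inverse[OF PQ] relation_ideal_closed(1))
  ultimately have "iso_substitution (relation_ideal M) (relation_ideal N) (linear_subst Q)"
    unfolding iso_substitution_def by blast
  then show ?thesis by (rule exI[of _ "linear_subst Q"])
qed

section \<open>Classification up to isomorphism\<close>

theorem theorem6p9:
  fixes f f' :: "'k::{alg_closed_field, field_char_0} free_xyz"
    and M M' :: "'k^3^3"
  assumes "homogeneous 2 f"
    and "homogeneous 2 f'"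
    and "\<exists>w \<in> {Word [Gx, Gx], Word [Gx, Gy], Word [Gy, Gx], Word [Gy, Gy]}.
           Poly_Mapping.lookup f w \<noteq> 0"
    and "\<exists>w \<in> {Word [Gx, Gx], Word [Gx, Gy], Word [Gy, Gx], Word [Gy, Gy]}.
           Poly_Mapping.lookup f' w \<noteq> 0"
    and "is_defining_matrix f M"
    and "is_defining_matrix f' M'"
  shows "sf_congruent M M' \<longleftrightarrow> algebra_isomorphic (H_algebra f) (H_algebra f')"
proof -
  have std: "M$3$1 = 0" "M$3$2 = 0" "M'$3$1 = 0" "M'$3$2 = 0"
    using assms(5,6) by (auto simp: is_defining_matrix_iff)
  have nz: "top_block_nonzero M" "top_block_nonzero M'"
    using assms(3-6) by (auto intro: defining_matrix_top_block_nonzero)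
  note gen = genideal_defining_matrix[OF assms(5)] genideal_defining_matrix[OF assms(6)]
  show ?thesis
  proof
    assume "sf_congruent M M'"
    from iso_substitution_if_sf_congruent[OF std this]
    obtain v where "iso_substitution (relation_ideal M) (relation_ideal M') v" by blast
    then show "algebra_isomorphic (H_algebra f) (H_algebra f')"
      unfolding H_algebra_def gen[symmetric] by (rule iso_substitution_imp_algebra_isomorphic)
  next
    assume "algebra_isomorphic (H_algebra f) (H_algebra f')"
    then obtain u where "iso_substitution (relation_ideal M) (relation_ideal M') u"
      using algebra_isomorphic_imp_substitution unfolding H_algebra_def by (metis gen)
    from iso_substitution_sym[OF relation_ideal this]
    obtain v where "iso_substitution (relation_ideal M') (relation_ideal M) v" by blast
    then show "sf_congruent M M'"
      by (rule sf_congruent_if_iso_substitution[OF std nz])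
  qed
qed

end
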